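(* Let $X$ and $Y$ be Tychonoff spaces and assume that $Y$ is $l$-dominated by $X$. If $X$ is a $\Delta$-space, then $Y$ is also a $\Delta$-space.
   Context: For a Tychonoff space $X$, $C_p(X)$ is the space of all real-valued continuous functions on $X$ endowed with the topology of pointwise convergence. A space $Y$ is $l$-dominated by a space $X$ if there exists a continuous linear surjection from $C_p(X)$ onto $C_p(Y)$. A topological space $X$ is a $\Delta$-space if for every decreasing sequence $\{D_n: n \in \omega\}$ of subsets of $X$ with empty intersection there is a decreasing sequence $\{V_n: n \in \omega\}$ of open subsets of $X$, also with empty intersection, such that $D_n \subset V_n$ for every $n \in \omega$. *)

theory Defs
  imports "HOL-Analysis.Analysis"
begin

definition Tychonoff_space :: "'a topology \<Rightarrow> bool" where
  "Tychonoff_space X \<longleftrightarrow> completely_regular_space X \<and> Hausdorff_space X"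

(* The topology of pointwise convergence is the one inherited from the product topology on
   R^X.  Points of product_topology are extensional functions (undefined off topspace X), so each
   continuous function on X has exactly one representative; see topspace_Cp. *)
definition Cp :: "'a topology \<Rightarrow> ('a \<Rightarrow> real) topology" where
  "Cp X = subtopology (product_topology (\<lambda>_. euclideanreal) (topspace X))
            {f. continuous_map X euclideanreal f}"

lemma topspace_Cp:
  "topspace (Cp X) = {f \<in> extensional (topspace X). continuous_map X euclideanreal f}"
  by (auto simp: Cp_def PiE_def)

(* The pointwise vector space operations are restricted to the carrier so that they stay within
   the extensional functions. *)
definition linear_Cp :: "'a topology \<Rightarrow> 'b topology \<Rightarrow> (('a \<Rightarrow> real) \<Rightarrow> ('b \<Rightarrow> real)) \<Rightarrow> bool" where
  "linear_Cp X Y T \<longleftrightarrow>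
     (\<forall>f \<in> topspace (Cp X). \<forall>g \<in> topspace (Cp X).
        T (\<lambda>x\<in>topspace X. f x + g x) = (\<lambda>y\<in>topspace Y. T f y + T g y)) \<and>
     (\<forall>c. \<forall>f \<in> topspace (Cp X).
        T (\<lambda>x\<in>topspace X. c * f x) = (\<lambda>y\<in>topspace Y. c * T f y))"

definition l_dominated_by :: "'b topology \<Rightarrow> 'a topology \<Rightarrow> bool" where
  "l_dominated_by Y X \<longleftrightarrow>
     (\<exists>T. continuous_map (Cp X) (Cp Y) T \<and> linear_Cp X Y T \<and>
          T ` topspace (Cp X) = topspace (Cp Y))"

definition Delta_space :: "'a topology \<Rightarrow> bool" where
  "Delta_space X \<longleftrightarrow>
     (\<forall>D :: nat \<Rightarrow> 'a set.
        (\<forall>n. D n \<subseteq> topspace X) \<and> decseq D \<and> (\<Inter>n. D n) = {} \<longrightarrow>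
        (\<exists>V :: nat \<Rightarrow> 'a set.
           (\<forall>n. openin X (V n)) \<and> decseq V \<and> (\<Inter>n. V n) = {} \<and> (\<forall>n. D n \<subseteq> V n)))"

end

theory Submission
  imports Defs "HOL-Library.Function_Algebras"
begin

text \<open>
  A space is a \<Delta>-space exactly when every real function on it, however discontinuous, is
  dominated by a finite function \<open>b\<close> in a locally uniform way: the value at a point \<open>x\<close> is at
  most \<open>b z\<close> for all \<open>z\<close> near \<open>x\<close> (\<open>Delta_space_iff_majorant\<close>). In this form the property can be
  carried along a continuous linear surjection \<open>T\<close> from \<open>C\<^sub>p(X)\<close> onto \<open>C\<^sub>p(Y)\<close>.

  For a fixed point \<open>y\<close>, the functional \<open>f \<mapsto> T f y\<close> is continuous, hence a finite linear
  combination of point evaluations, so \<open>T\<close> is given by a matrix \<open>c\<close> all of whose rows \<open>c y\<close> have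
  finite support (\<open>l_dominated_matrix\<close>). This matrix also acts on discontinuous functions. Because
  \<open>T\<close> is onto and continuous functions on \<open>Y\<close> separate finite sets, the rows are linearly
  independent, and therefore the extended map from all functions on \<open>X\<close> to all functions on \<open>Y\<close> is
  again onto (\<open>independent_rows_solvable\<close>).

  Given an arbitrary \<open>f\<close> on \<open>Y\<close>, choose \<open>g\<close> on \<open>X\<close> that the matrix sends to \<open>f + 1\<close>, and a locally
  uniform majorant \<open>b\<close> of \<open>\<bar>g\<bar>\<close>. The set of continuous \<open>h\<close> with \<open>\<bar>h\<bar> \<le> b\<close> is large enough to interpolate
  \<open>g\<close> on every finite set (\<open>Tychonoff_interpolation\<close>), while its image under \<open>T\<close> is bounded at
  each \<open>z\<close> by \<open>\<beta> z = (\<Sum>x. \<bar>c z x\<bar> * b x)\<close>. For \<open>y\<close> in \<open>Y\<close> take \<open>h\<close> equal to \<open>g\<close> on the support of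
  the row of \<open>y\<close>. Then \<open>T h y = f y + 1\<close>, so by continuity
  \<open>f y < T h z \<le> \<beta> z\<close> for all \<open>z\<close> near \<open>y\<close>, and \<open>\<beta>\<close> is the required majorant of \<open>f\<close>.
\<close>

section \<open>Delta-spaces and locally dominating majorants\<close>

text \<open>
  A decreasing sequence of sets with empty intersection is the same thing as a function with
  natural-number values: the indices \<open>m\<close> with \<open>z \<in> A m\<close> form an initial segment of the naturals,
  and their number records the whole membership pattern of \<open>z\<close>. Both directions of the
  characterization of \<Delta>-spaces rest on this translation.
\<close>

lemma decseq_mem_iff_less_card:
  fixes A :: "nat \<Rightarrow> 'a set"
  assumes "decseq A" and "z \<notin> (\<Inter>n. A n)"
  shows "z \<in> A n \<longleftrightarrow> n < card {m. z \<in> A m}"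
proof -
  define N where "N = (LEAST n. z \<notin> A n)"
  have out: "z \<notin> A N"
    unfolding N_def by (rule LeastI_ex) (use assms(2) in auto)
  have iff: "z \<in> A m \<longleftrightarrow> m < N" for m
  proof
    show "m < N" if "z \<in> A m"
    proof (rule ccontr)
      assume "\<not> m < N"
      then have "A m \<subseteq> A N" using assms(1) by (auto simp: decseq_def)
      then show False using that out by blast
    qed
    show "z \<in> A m" if "m < N"
      using not_less_Least[of m "\<lambda>n. z \<notin> A n"] that unfolding N_def by blast
  qed
  then have "{m. z \<in> A m} = {..<N}" by auto
  then show ?thesis using iff by simp
qed

text \<open>
  Sequences of sets correspond to functions through their level sets. The sequence \<open>D\<close> of
  superlevel sets of \<open>g\<close> and its open expansion \<open>V\<close> turn into \<open>g\<close> and the level function of \<open>V\<close>;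
  openness of \<open>V\<close> makes the domination uniform near each point. Conversely, a majorant of the
  level function of \<open>D\<close> has superlevel sets whose interiors form an open expansion of \<open>D\<close>.
\<close>

lemma Delta_space_iff_majorant:
  fixes X :: "'a topology"
  shows "Delta_space X \<longleftrightarrow>
    (\<forall>g :: 'a \<Rightarrow> real. \<exists>b :: 'a \<Rightarrow> real. \<forall>x \<in> topspace X.
       \<exists>U. openin X U \<and> x \<in> U \<and> (\<forall>z \<in> U. g x \<le> b z))"
    (is "_ \<longleftrightarrow> ?maj")
proof
  assume Delta: "Delta_space X"
  show ?maj
  proof
    fix g :: "'a \<Rightarrow> real"
    define D where "D n = {x \<in> topspace X. real n \<le> g x}" for n
    have "decseq D" by (auto simp: decseq_def D_def)
    moreover have "(\<Inter>n. D n) = {}"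
    proof -
      have "x \<notin> D (nat \<lceil>g x\<rceil> + 1)" for x
        unfolding D_def by (simp, linarith)
      then show ?thesis by blast
    qed
    moreover have "\<forall>n. D n \<subseteq> topspace X" by (auto simp: D_def)
    ultimately obtain V where V: "\<And>n. openin X (V n)" "decseq V" "(\<Inter>n. V n) = {}"
      and DV: "\<And>n. D n \<subseteq> V n"
      using Delta unfolding Delta_space_def by meson
    \<comment> \<open>The majorant is the number of sets \<open>V n\<close> that contain the point: it exceeds
      \<open>n\<close> exactly on \<open>V n\<close>.\<close>
    define level where "level z = card {n. z \<in> V n}" for z
    have level: "z \<in> V n \<longleftrightarrow> n < level z" for z n
      unfolding level_def using V(2,3) by (intro decseq_mem_iff_less_card) auto
    show "\<exists>b :: 'a \<Rightarrow> real. \<forall>x \<in> topspace X. \<exists>U. openin X U \<and> x \<in> U \<and> (\<forall>z \<in> U. g x \<le> b z)"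
    proof (intro exI[of _ "\<lambda>z. real (level z)"] ballI)
      fix x assume x: "x \<in> topspace X"
      have "x \<notin> D (level x)" using DV level[of x "level x"] by auto
      then have gx: "g x < real (level x)" using x by (auto simp: D_def)
      show "\<exists>U. openin X U \<and> x \<in> U \<and> (\<forall>z \<in> U. g x \<le> real (level z))"
      proof (cases "level x")
        \<comment> \<open>Here no set \<open>V n\<close> contains \<open>x\<close>, but \<open>g x\<close> is negative, so the whole space serves.\<close>
        case 0
        then show ?thesis using gx x by (intro exI[of _ "topspace X"]) auto
      next
        case (Suc n)
        have "g x \<le> real (level z)" if "z \<in> V n" for z
          using that gx level[of z n] Suc by linarith
        then show ?thesis using V(1) level[of x n] Suc by (intro exI[of _ "V n"]) auto
      qed
    qed
  qed
next
  assume maj: ?maj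
  show "Delta_space X"
    unfolding Delta_space_def
  proof (intro allI impI, elim conjE)
    fix D :: "nat \<Rightarrow> 'a set"
    assume sub: "\<forall>n. D n \<subseteq> topspace X" and dec: "decseq D" and empty: "(\<Inter>n. D n) = {}"
    obtain b :: "'a \<Rightarrow> real" where b: "\<And>x. x \<in> topspace X \<Longrightarrow>
        \<exists>U. openin X U \<and> x \<in> U \<and> (\<forall>z \<in> U. real (card {n. x \<in> D n}) \<le> b z)"
      using maj[rule_format, of "\<lambda>x. real (card {n. x \<in> D n})"] by blast
    define V where "V n = \<Union>{U. openin X U \<and> (\<forall>z \<in> U. real n < b z)}" for n
    have V_less: "real n < b z" if "z \<in> V n" for n z
      using that by (auto simp: V_def)
    have "openin X (V n)" for n
      unfolding V_def by (rule openin_Union) auto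
    moreover have "decseq V"
      unfolding decseq_def
    proof (intro allI impI subsetI)
      fix m n z assume mn: "m \<le> n" and "z \<in> V n"
      then obtain U where U: "openin X U" "z \<in> U" "\<forall>w \<in> U. real n < b w"
        by (auto simp: V_def)
      have "\<forall>w \<in> U. real m < b w"
        using U(3) mn by (meson of_nat_le_iff order.strict_trans1)
      then show "z \<in> V m" using U(1,2) by (auto simp: V_def)
    qed
    moreover have "(\<Inter>n. V n) = {}"
    proof -
      have "z \<notin> V (nat \<lceil>b z\<rceil>)" for z
        using V_less[of z "nat \<lceil>b z\<rceil>"] by linarith
      then show ?thesis by blast
    qed
    moreover have "D n \<subseteq> V n" for n
    proof
      fix x assume x: "x \<in> D n"
      then have "x \<in> topspace X" using sub by blast
      from b[OF this] obtain U where U: "openin X U" "x \<in> U"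
        "\<forall>z \<in> U. real (card {n. x \<in> D n}) \<le> b z"
        by (elim exE conjE) (rule that)
      have "n < card {n. x \<in> D n}"
        using x decseq_mem_iff_less_card[OF dec, of x n] empty by auto
      then have "\<forall>z \<in> U. real n < b z" using U(3) by fastforce
      then show "x \<in> V n" using U(1,2) by (auto simp: V_def)
    qed
    ultimately show "\<exists>V. (\<forall>n. openin X (V n)) \<and> decseq V \<and> (\<Inter>n. V n) = {} \<and> (\<forall>n. D n \<subseteq> V n)"
      by blast
  qed
qed

section \<open>Interpolation in Tychonoff spaces\<close>

lemma restrict_in_Cp:
  assumes "continuous_map X euclideanreal f"
  shows "restrict f (topspace X) \<in> topspace (Cp X)"
  using continuous_map_eq[OF assms, of "restrict f (topspace X)"] by (simp add: topspace_Cp)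

text \<open>
  Values prescribed at finitely many points can be attained by a continuous function that obeys the
  pointwise bound \<open>b\<close> everywhere, although \<open>b\<close> itself may be discontinuous. Points are added one
  at a time: the function found so far is replaced near the new point \<open>x\<close> by its convex combination
  with the constant \<open>f x\<close>. Convexity preserves the bound, since both ingredients obey it there.
\<close>

lemma Tychonoff_interpolation:
  fixes f b :: "'a \<Rightarrow> real"
  assumes "Tychonoff_space X" and "finite F" and "F \<subseteq> topspace X"
    and b_nonneg: "\<And>z. z \<in> topspace X \<Longrightarrow> 0 \<le> b z"
    and bound: "\<And>x. x \<in> F \<Longrightarrow> \<exists>U. openin X U \<and> x \<in> U \<and> (\<forall>z \<in> U. \<bar>f x\<bar> \<le> b z)"
  obtains g where "g \<in> topspace (Cp X)" and "\<And>x. x \<in> F \<Longrightarrow> g x = f x"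
    and "\<And>z. z \<in> topspace X \<Longrightarrow> \<bar>g z\<bar> \<le> b z"
proof -
  have "\<exists>g. continuous_map X euclideanreal g \<and> (\<forall>x\<in>F. g x = f x) \<and>
      (\<forall>z \<in> topspace X. \<bar>g z\<bar> \<le> b z)"
    using assms(2,3) bound
  proof (induction F)
    case empty
    then show ?case using b_nonneg by (intro exI[of _ "\<lambda>_. 0"]) auto
  next
    case (insert x F)
    then obtain g where g: "continuous_map X euclideanreal g" "\<And>x. x \<in> F \<Longrightarrow> g x = f x"
      "\<And>z. z \<in> topspace X \<Longrightarrow> \<bar>g z\<bar> \<le> b z"
      by auto
    obtain U where U: "openin X U" "x \<in> U" "\<And>z. z \<in> U \<Longrightarrow> \<bar>f x\<bar> \<le> b z"
      using insert.prems(2)[of x] by auto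
    have "t1_space X"
      using assms(1) by (simp add: Tychonoff_space_def Hausdorff_imp_t1_space)
    then have "closedin X F"
      using insert by (auto simp: t1_space_closedin_finite)
    then have "openin X (U - F)" "x \<in> U - F"
      using U insert.hyps by (auto intro: openin_diff)
    then have "closedin X (topspace X - (U - F))" "x \<in> topspace X - (topspace X - (U - F))"
      using openin_subset by auto
    then obtain p where p: "continuous_map X (top_of_set {0..1::real}) p" "p x = 0"
      "p ` (topspace X - (U - F)) \<subseteq> {1}"
      using assms(1) unfolding Tychonoff_space_def completely_regular_space_def by meson
    \<comment> \<open>The weight \<open>p\<close> equals 1 on the old points and outside \<open>U\<close>, where nothing may change.\<close>
    have cp: "continuous_map X euclideanreal p" and p01: "\<And>z. z \<in> topspace X \<Longrightarrow> 0 \<le> p z \<and> p z \<le> 1"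
      using p(1) by (auto simp: continuous_map_in_subtopology Pi_iff image_subset_iff)
    define h where "h z = p z * g z + (1 - p z) * f x" for z
    have "continuous_map X euclideanreal h"
      unfolding h_def using cp g(1) by (intro continuous_intros) auto
    moreover have "h z = f z" if "z \<in> insert x F" for z
    proof (cases "z = x")
      case True
      then show ?thesis using p(2) by (simp add: h_def)
    next
      case False
      then have "z \<in> F" using that by simp
      moreover have "p z = 1"
        using p(3) \<open>z \<in> F\<close> insert.prems(1) by blast
      ultimately show ?thesis using g(2) by (simp add: h_def)
    qed
    moreover have "\<bar>h z\<bar> \<le> b z" if z: "z \<in> topspace X" for z
    proof (cases "z \<in> U - F")
      case True
      have "\<bar>h z\<bar> \<le> p z * \<bar>g z\<bar> + (1 - p z) * \<bar>f x\<bar>"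
        unfolding h_def using p01[OF z] abs_triangle_ineq[of "p z * g z" "(1 - p z) * f x"]
        by (simp add: abs_mult)
      also have "\<dots> \<le> p z * b z + (1 - p z) * b z"
        using p01[OF z] g(3)[OF z] U(3)[of z] True by (intro add_mono mult_left_mono) auto
      finally show ?thesis by (simp add: algebra_simps)
    next
      case False
      then have "p z = 1" using p(3) z by blast
      then show ?thesis using g(3)[OF z] by (simp add: h_def)
    qed
    ultimately show ?case by blast
  qed
  then obtain g where g: "continuous_map X euclideanreal g" "\<forall>x\<in>F. g x = f x"
      "\<forall>z \<in> topspace X. \<bar>g z\<bar> \<le> b z" by blast
  show thesis
  proof (rule that)
    show "restrict g (topspace X) \<in> topspace (Cp X)"
      using g(1) by (rule restrict_in_Cp)
  qed (use g assms(3) in auto)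
qed

lemma Tychonoff_separates_finite:
  assumes "Tychonoff_space X" and "finite F" and "F \<subseteq> topspace X"
  obtains g where "g \<in> topspace (Cp X)" and "\<And>z. z \<in> F \<Longrightarrow> g z = of_bool (z = x)"
proof -
  have "\<exists>U. openin X U \<and> y \<in> U \<and> (\<forall>z\<in>U. \<bar>of_bool (y = x)\<bar> \<le> (1::real))" if "y \<in> F" for y
    using that assms(3) by (intro exI[of _ "topspace X"]) auto
  then show thesis
    using Tychonoff_interpolation[OF assms, of "\<lambda>_. 1" "\<lambda>z. of_bool (z = x)"] that
    by (metis zero_le_one)
qed

section \<open>The dual of the space of continuous functions\<close>

lemma Cp_linear_combination:
  assumes "f \<in> topspace (Cp X)" "g \<in> topspace (Cp X)"
  shows "(\<lambda>x\<in>topspace X. f x + g x) \<in> topspace (Cp X)"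
    and "(\<lambda>x\<in>topspace X. c * f x) \<in> topspace (Cp X)"
proof -
  have cf: "continuous_map X euclideanreal f" and cg: "continuous_map X euclideanreal g"
    using assms by (auto simp: topspace_Cp)
  have "continuous_map X euclideanreal (\<lambda>x. f x + g x)"
    "continuous_map X euclideanreal (\<lambda>x. c * f x)"
    using cf cg by (intro continuous_intros; simp)+
  then show "(\<lambda>x\<in>topspace X. f x + g x) \<in> topspace (Cp X)"
    "(\<lambda>x\<in>topspace X. c * f x) \<in> topspace (Cp X)"
    by (simp_all only: restrict_in_Cp)
qed

definition linear_functional_Cp :: "'a topology \<Rightarrow> (('a \<Rightarrow> real) \<Rightarrow> real) \<Rightarrow> bool" where
  "linear_functional_Cp X \<Phi> \<longleftrightarrow>
     (\<forall>f \<in> topspace (Cp X). \<forall>g \<in> topspace (Cp X).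
        \<Phi> (\<lambda>x\<in>topspace X. f x + g x) = \<Phi> f + \<Phi> g) \<and>
     (\<forall>c. \<forall>f \<in> topspace (Cp X). \<Phi> (\<lambda>x\<in>topspace X. c * f x) = c * \<Phi> f)"

text \<open>
  A functional that depends only on the values on \<open>F\<close> factors through a finite-dimensional
  space. The induction removes one point \<open>x\<close>: subtracting the multiple \<open>\<Phi> \<phi>\<close> of the evaluation at
  \<open>x\<close>, where \<open>\<phi>\<close> is 1 at \<open>x\<close> and 0 on the remaining points, leaves a functional that depends only
  on the remaining points.
\<close>

lemma linear_functional_Cp_eq_sum:
  assumes "Tychonoff_space X" and "finite F" and "F \<subseteq> topspace X"
    and "linear_functional_Cp X \<Phi>"
    and "\<And>f. f \<in> topspace (Cp X) \<Longrightarrow> \<forall>x \<in> F. f x = 0 \<Longrightarrow> \<Phi> f = 0"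
  shows "\<exists>c. (\<forall>x. x \<notin> F \<longrightarrow> c x = 0) \<and> (\<forall>f \<in> topspace (Cp X). \<Phi> f = (\<Sum>x\<in>F. c x * f x))"
  using assms(2-5)
proof (induction F arbitrary: \<Phi>)
  case empty
  then show ?case by (intro exI[of _ "\<lambda>_. 0"]) auto
next
  case (insert x F)
  note lin = insert.prems(2)[unfolded linear_functional_Cp_def]
  have x: "x \<in> topspace X" using insert.prems by auto
  obtain \<phi> where \<phi>: "\<phi> \<in> topspace (Cp X)" "\<And>z. z \<in> insert x F \<Longrightarrow> \<phi> z = of_bool (z = x)"
    using Tychonoff_separates_finite[OF assms(1), of "insert x F" x] insert by auto
  define \<Psi> where "\<Psi> f = \<Phi> f - f x * \<Phi> \<phi>" for f
  have "linear_functional_Cp X \<Psi>"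
    using lin x by (auto simp: linear_functional_Cp_def \<Psi>_def algebra_simps)
  moreover have "\<Psi> f = 0" if f: "f \<in> topspace (Cp X)" "\<forall>x \<in> F. f x = 0" for f
  proof -
    define s where "s = (\<lambda>z\<in>topspace X. - f x * \<phi> z)"
    have s: "s \<in> topspace (Cp X)"
      unfolding s_def by (rule Cp_linear_combination(2)[OF \<phi>(1) \<phi>(1)])
    have "\<Phi> (\<lambda>z\<in>topspace X. f z + s z) = 0"
    proof (rule insert.prems(3))
      show "(\<lambda>z\<in>topspace X. f z + s z) \<in> topspace (Cp X)"
        by (rule Cp_linear_combination(1)[OF f(1) s])
      show "\<forall>z\<in>insert x F. (\<lambda>z\<in>topspace X. f z + s z) z = 0"
        using f(2) \<phi>(2) insert.prems(1) insert.hyps by (auto simp: s_def)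
    qed
    moreover have "\<Phi> (\<lambda>z\<in>topspace X. f z + s z) = \<Phi> f + \<Phi> s"
      using lin f s by blast
    moreover have "\<Phi> s = - f x * \<Phi> \<phi>"
      unfolding s_def using lin \<phi>(1) by blast
    ultimately show ?thesis by (simp add: \<Psi>_def)
  qed
  ultimately have "\<exists>c. (\<forall>z. z \<notin> F \<longrightarrow> c z = 0) \<and>
      (\<forall>f \<in> topspace (Cp X). \<Psi> f = (\<Sum>z\<in>F. c z * f z))"
    using insert.prems(1) by (intro insert.IH) auto
  then obtain c where c: "\<And>z. z \<notin> F \<Longrightarrow> c z = 0"
    "\<And>f. f \<in> topspace (Cp X) \<Longrightarrow> \<Psi> f = (\<Sum>z\<in>F. c z * f z)"
    by blast
  have "\<Phi> f = (\<Sum>z\<in>insert x F. (c(x := \<Phi> \<phi>)) z * f z)" if "f \<in> topspace (Cp X)" for f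
  proof -
    have "(\<Sum>z\<in>F. (c(x := \<Phi> \<phi>)) z * f z) = (\<Sum>z\<in>F. c z * f z)"
      using insert.hyps by (intro sum.cong) auto
    then show ?thesis using c(2)[OF that] insert.hyps by (simp add: \<Psi>_def algebra_simps)
  qed
  then show ?case using c(1) by (intro exI[of _ "c(x := \<Phi> \<phi>)"]) auto
qed

text \<open>
  Continuity at 0 bounds \<open>\<Phi>\<close> by 1 on a basic neighbourhood, which restricts only finitely many
  coordinates. If \<open>f\<close> vanishes at these, then every multiple of \<open>f\<close> lies in the neighbourhood,
  and a linear functional that is bounded on a line through the origin is 0 on it.
\<close>

lemma continuous_functional_Cp_finite_support:
  assumes cont: "continuous_map (Cp X) euclideanreal \<Phi>"
    and lin: "linear_functional_Cp X \<Phi>"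
  obtains F where "finite F" "F \<subseteq> topspace X"
    "\<And>f. f \<in> topspace (Cp X) \<Longrightarrow> \<forall>x \<in> F. f x = 0 \<Longrightarrow> \<Phi> f = 0"
proof -
  define zero where "zero = (\<lambda>x\<in>topspace X. 0::real)"
  have zero: "zero \<in> topspace (Cp X)"
    unfolding zero_def by (rule restrict_in_Cp) simp
  have "\<Phi> zero = 0"
    using lin[unfolded linear_functional_Cp_def, THEN conjunct2, rule_format, OF zero, of 0]
    by (simp add: zero_def cong: restrict_cong)
  define W where "W = {f \<in> topspace (Cp X). \<Phi> f \<in> ball 0 1}"
  have "openin (Cp X) W"
    unfolding W_def using cont by (rule openin_continuous_map_preimage) simp
  then obtain W' where W': "openin (product_topology (\<lambda>_. euclideanreal) (topspace X)) W'"
    and W_eq: "W = W' \<inter> {f. continuous_map X euclideanreal f}"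
    unfolding Cp_def openin_subtopology by (elim exE conjE) (rule that)
  have "zero \<in> W"
    unfolding W_def using zero \<open>\<Phi> zero = 0\<close> by simp
  then have "zero \<in> W'" by (simp only: W_eq IntD1)
  have "\<exists>U. finite {i \<in> topspace X. U i \<noteq> UNIV} \<and> (\<forall>i \<in> topspace X. open (U i)) \<and>
      zero \<in> Pi\<^sub>E (topspace X) U \<and> Pi\<^sub>E (topspace X) U \<subseteq> W'"
    using W'[unfolded openin_product_topology_alt, rule_format, OF \<open>zero \<in> W'\<close>] by simp
  then obtain U where U: "finite {i \<in> topspace X. U i \<noteq> UNIV}"
    "zero \<in> Pi\<^sub>E (topspace X) U" "Pi\<^sub>E (topspace X) U \<subseteq> W'"
    by (elim exE conjE) (rule that)
  show thesis
  proof (rule that)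
    show "finite {i \<in> topspace X. U i \<noteq> UNIV}" by (rule U(1))
    show "{i \<in> topspace X. U i \<noteq> UNIV} \<subseteq> topspace X" by blast
    fix f assume f: "f \<in> topspace (Cp X)" "\<forall>x \<in> {i \<in> topspace X. U i \<noteq> UNIV}. f x = 0"
    have small: "\<bar>c * \<Phi> f\<bar> < 1" for c
    proof -
      let ?cf = "\<lambda>x\<in>topspace X. c * f x"
      have cf: "?cf \<in> topspace (Cp X)"
        by (rule Cp_linear_combination(2)[OF f(1) f(1)])
      have "?cf x \<in> U x" if "x \<in> topspace X" for x
      proof (cases "U x = UNIV")
        case False
        then have "?cf x = zero x" using f(2) that by (simp add: zero_def)
        then show ?thesis using U(2) that by (metis PiE_mem)
      qed simp
      then have "?cf \<in> W'" using U(3) by (auto simp: PiE_iff)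
      then have "?cf \<in> W" unfolding W_eq using cf by (simp add: topspace_Cp)
      then show ?thesis
        using lin f(1) by (auto simp: W_def linear_functional_Cp_def)
    qed
    show "\<Phi> f = 0"
      using small[of "1 / \<Phi> f"] by (cases "\<Phi> f = 0") auto
  qed
qed

section \<open>Infinite systems of linear equations with finite rows\<close>

text \<open>
  A system of linear equations, each involving finitely many of possibly infinitely many unknowns,
  is solvable for every right-hand side as soon as the rows are linearly independent: there is then a
  linear form \<open>L\<close> on all functions with the prescribed values on the rows, and its values on the
  unit vectors solve the system, because each row is a finite combination of unit vectors.
\<close>

lemma independent_rows_solvable:
  fixes r :: "'b \<Rightarrow> 'a \<Rightarrow> real" and f :: "'b \<Rightarrow> real"
  assumes fin: "\<And>y. y \<in> Y \<Longrightarrow> finite (F y)"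
    and supp: "\<And>y x. y \<in> Y \<Longrightarrow> x \<notin> F y \<Longrightarrow> r y x = 0"
    and indep: "\<And>S a y. finite S \<Longrightarrow> S \<subseteq> Y \<Longrightarrow> \<forall>x. (\<Sum>y\<in>S. a y * r y x) = 0 \<Longrightarrow> y \<in> S \<Longrightarrow> a y = 0"
  shows "\<exists>g. \<forall>y \<in> Y. (\<Sum>x\<in>F y. r y x * g x) = f y"
proof -
  let ?scale = "\<lambda>(c::real) (h :: 'a \<Rightarrow> real) x. c * h x"
  interpret vector_space_pair ?scale "(*) :: real \<Rightarrow> real \<Rightarrow> real"
    by unfold_locales (auto simp: fun_eq_iff algebra_simps)
  have sum_apply: "(\<Sum>i\<in>I. h i) x = (\<Sum>i\<in>I. h i x)" for I and h :: "'c \<Rightarrow> 'a \<Rightarrow> real" and x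
    by (induction I rule: infinite_finite_induct) auto
  \<comment> \<open>Independence of the indexed family excludes equal rows, so it passes to the set of rows.\<close>
  have inj: "inj_on r Y"
  proof (rule inj_onI, rule ccontr)
    fix y z assume yz: "y \<in> Y" "z \<in> Y" "r y = r z" "y \<noteq> z"
    then have "\<forall>x. (\<Sum>w\<in>{y, z}. (if w = y then 1 else - 1) * r w x) = 0" by simp
    from indep[OF _ _ this, of y] yz show False by simp
  qed
  have "vs1.independent (r ` Y)"
    unfolding vs1.independent_explicit_module
  proof (intro allI impI)
    fix t :: "('a \<Rightarrow> real) set" and u v
    assume t: "finite t" "t \<subseteq> r ` Y" and zero: "(\<Sum>v\<in>t. ?scale (u v) v) = 0" and v: "v \<in> t"
    obtain S where S: "S \<subseteq> Y" "finite S" "t = r ` S"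
      using finite_subset_image[OF t] by blast
    have injS: "inj_on r S" using inj S(1) by (rule inj_on_subset)
    have "(\<Sum>y\<in>S. u (r y) * r y x) = 0" for x
    proof -
      have "(\<Sum>y\<in>S. u (r y) * r y x) = (\<Sum>v\<in>t. ?scale (u v) v) x"
        unfolding S(3) sum_apply by (simp add: sum.reindex[OF injS])
      then show ?thesis using zero by simp
    qed
    moreover obtain y where "y \<in> S" "v = r y" using v S(3) by blast
    ultimately show "u v = 0" using indep[OF S(2,1), of "\<lambda>y. u (r y)" y] by simp
  qed
  then obtain L where lin: "Vector_Spaces.linear ?scale (*) L"
    and L: "\<forall>v \<in> r ` Y. L v = f (inv_into Y r v)"
    using linear_independent_extend[of "r ` Y" "\<lambda>v. f (inv_into Y r v)"] by blast
  interpret L: Vector_Spaces.linear ?scale "(*)" L by (rule lin)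
  show ?thesis
  proof (intro exI[of _ "\<lambda>x. L (\<lambda>z. of_bool (z = x))"] ballI)
    fix y assume y: "y \<in> Y"
    have row: "r y = (\<Sum>x\<in>F y. ?scale (r y x) (\<lambda>z. of_bool (z = x)))"
    proof
      fix z
      have "(\<Sum>x\<in>F y. r y x * of_bool (z = x)) = (if z \<in> F y then r y z else 0)"
        using fin[OF y] by (simp add: of_bool_def sum.delta' if_distrib cong: if_cong)
      then show "r y z = (\<Sum>x\<in>F y. ?scale (r y x) (\<lambda>z. of_bool (z = x))) z"
        unfolding sum_apply using supp[OF y, of z] by auto
    qed
    have "f y = L (r y)" using L y inj by simp
    also have "\<dots> = (\<Sum>x\<in>F y. r y x * L (\<lambda>z. of_bool (z = x)))"
      by (subst row) (simp add: L.sum L.scale)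
    finally show "(\<Sum>x\<in>F y. r y x * L (\<lambda>z. of_bool (z = x))) = f y" by simp
  qed
qed

section \<open>Transfer along a continuous linear surjection\<close>

lemma bchoice2:
  assumes "\<And>y. y \<in> A \<Longrightarrow> \<exists>u v. P y u v"
  shows "\<exists>f g. \<forall>y \<in> A. P y (f y) (g y)"
  using assms by metis

text \<open>
  Composing \<open>T\<close> with the evaluation at \<open>y\<close> gives a continuous linear functional, hence a finite
  combination of evaluations; its coefficients form the row of the matrix at \<open>y\<close>.
\<close>

lemma l_dominated_matrix:
  fixes X :: "'a topology" and Y :: "'b topology"
  assumes "Tychonoff_space X" and "continuous_map (Cp X) (Cp Y) T" and "linear_Cp X Y T"
  shows "\<exists>F c. \<forall>y \<in> topspace Y. finite (F y) \<and> F y \<subseteq> topspace X \<and>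
      (\<forall>x. x \<notin> F y \<longrightarrow> c y x = 0) \<and>
      (\<forall>f \<in> topspace (Cp X). T f y = (\<Sum>x\<in>F y. c y x * f x))"
proof -
  have "\<exists>F c. finite F \<and> F \<subseteq> topspace X \<and> (\<forall>x. x \<notin> F \<longrightarrow> c x = 0) \<and>
      (\<forall>f \<in> topspace (Cp X). T f y = (\<Sum>x\<in>F. c x * f x))" if y: "y \<in> topspace Y" for y
  proof -
    have "continuous_map (Cp Y) euclideanreal (\<lambda>h. h y)"
      unfolding Cp_def using y
      by (intro continuous_map_from_subtopology continuous_map_product_projection)
    then have "continuous_map (Cp X) euclideanreal (\<lambda>f. T f y)"
      using continuous_map_compose[OF assms(2)] by (simp add: o_def)
    moreover have lin: "linear_functional_Cp X (\<lambda>f. T f y)"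
      using assms(3) y by (simp add: linear_Cp_def linear_functional_Cp_def)
    ultimately obtain F where F: "finite F" "F \<subseteq> topspace X"
      "\<And>f. f \<in> topspace (Cp X) \<Longrightarrow> \<forall>x \<in> F. f x = 0 \<Longrightarrow> T f y = 0"
      using continuous_functional_Cp_finite_support by blast
    show ?thesis
      using linear_functional_Cp_eq_sum[OF assms(1) F(1,2) lin F(3)] F(1,2) by blast
  qed
  then show ?thesis by (intro bchoice2)
qed

theorem theorem3p1:
  fixes X :: "'a topology" and Y :: "'b topology"
  assumes "Tychonoff_space X" and "Tychonoff_space Y"
    and "l_dominated_by Y X"
    and "Delta_space X"
  shows "Delta_space Y"
proof -
  obtain T where T: "continuous_map (Cp X) (Cp Y) T" "linear_Cp X Y T"
    and surj: "T ` topspace (Cp X) = topspace (Cp Y)"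
    using assms(3) unfolding l_dominated_by_def by (elim exE conjE) (rule that)
  obtain F c where Fc: "\<forall>y \<in> topspace Y. finite (F y) \<and> F y \<subseteq> topspace X \<and>
      (\<forall>x. x \<notin> F y \<longrightarrow> c y x = 0) \<and>
      (\<forall>f \<in> topspace (Cp X). T f y = (\<Sum>x\<in>F y. c y x * f x))"
    using l_dominated_matrix[OF assms(1) T] by (elim exE) (rule that)
  have F: "finite (F y)" "F y \<subseteq> topspace X" if "y \<in> topspace Y" for y
    using Fc that by auto
  have c: "c y x = 0" if "y \<in> topspace Y" "x \<notin> F y" for y x
    using Fc that by auto
  have T_eq: "T f y = (\<Sum>x\<in>F y. c y x * f x)" if "y \<in> topspace Y" "f \<in> topspace (Cp X)" for y f
    using Fc that by auto
  \<comment> \<open>A relation between the rows would hold between the values at the points of \<open>S\<close> of every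
    function in the range of \<open>T\<close>; the range contains one that is 1 at \<open>y\<close> and 0 on the rest.\<close>
  have indep: "a y = 0"
    if S: "finite S" "S \<subseteq> topspace Y" and dep: "\<forall>x. (\<Sum>y\<in>S. a y * c y x) = 0" and y: "y \<in> S"
    for S a y
  proof -
    obtain h where h: "h \<in> topspace (Cp Y)" "\<And>z. z \<in> S \<Longrightarrow> h z = of_bool (z = y)"
      using Tychonoff_separates_finite[OF assms(2) S, of y] by blast
    have "h \<in> T ` topspace (Cp X)" using h(1) by (simp only: surj)
    then obtain f where f: "f \<in> topspace (Cp X)" "T f = h" by auto
    define G where "G = (\<Union>z\<in>S. F z)"
    have G: "finite G" using S F(1) by (auto simp: G_def)
    have row: "h z = (\<Sum>x\<in>G. c z x * f x)" if "z \<in> S" for z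
    proof -
      have "h z = (\<Sum>x\<in>F z. c z x * f x)" using T_eq[OF subsetD[OF S(2) that] f(1)] f(2) by simp
      also have "\<dots> = (\<Sum>x\<in>G. c z x * f x)"
        using that S(2) c G by (intro sum.mono_neutral_left) (auto simp: G_def)
      finally show ?thesis .
    qed
    have "(\<Sum>z\<in>S. a z * h z) = (\<Sum>z\<in>S. if z = y then a z else 0)"
      using h(2) by (intro sum.cong) auto
    then have "a y = (\<Sum>z\<in>S. a z * h z)" using S(1) y by simp
    also have "\<dots> = (\<Sum>z\<in>S. \<Sum>x\<in>G. a z * c z x * f x)"
      using row by (simp add: sum_distrib_left mult.assoc)
    also have "\<dots> = (\<Sum>x\<in>G. (\<Sum>z\<in>S. a z * c z x) * f x)"
      by (subst sum.swap) (simp add: sum_distrib_right)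
    also have "\<dots> = 0" using dep by simp
    finally show ?thesis .
  qed
  show ?thesis
    unfolding Delta_space_iff_majorant
  proof
    fix f :: "'b \<Rightarrow> real"
    \<comment> \<open>The summand 1 gives the strict inequality at \<open>y\<close> that continuity spreads to nearby points.\<close>
    have "\<exists>g. \<forall>y \<in> topspace Y. (\<Sum>x\<in>F y. c y x * g x) = f y + 1"
    proof (rule independent_rows_solvable)
      fix S a y
      assume "finite S" "S \<subseteq> topspace Y" "\<forall>x. (\<Sum>y\<in>S. a y * c y x) = 0" "y \<in> S"
      then show "a y = 0" by (rule indep)
    qed (use F(1) c in auto)
    then obtain g where g: "\<forall>y \<in> topspace Y. (\<Sum>x\<in>F y. c y x * g x) = f y + 1"
      by (elim exE) (rule that)
    obtain b :: "'a \<Rightarrow> real" where b: "\<And>x. x \<in> topspace X \<Longrightarrow>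
        \<exists>U. openin X U \<and> x \<in> U \<and> (\<forall>z \<in> U. \<bar>g x\<bar> \<le> b z)"
      using assms(4)[unfolded Delta_space_iff_majorant, rule_format, of "\<lambda>x. \<bar>g x\<bar>"] by blast
    have b_nonneg: "0 \<le> b x" if "x \<in> topspace X" for x
      using b[OF that] abs_ge_zero order.trans by blast
    show "\<exists>b :: 'b \<Rightarrow> real. \<forall>y \<in> topspace Y. \<exists>U. openin Y U \<and> y \<in> U \<and> (\<forall>z \<in> U. f y \<le> b z)"
    proof (intro exI[of _ "\<lambda>z. \<Sum>x\<in>F z. \<bar>c z x\<bar> * b x"] ballI)
      fix y assume y: "y \<in> topspace Y"
      have "\<exists>U. openin X U \<and> x \<in> U \<and> (\<forall>z \<in> U. \<bar>g x\<bar> \<le> b z)" if "x \<in> F y" for x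
        using b F(2)[OF y] that by blast
      from Tychonoff_interpolation[where f = g and b = b,
          OF assms(1) F(1)[OF y] F(2)[OF y] b_nonneg this]
      obtain h where h: "h \<in> topspace (Cp X)" "\<And>x. x \<in> F y \<Longrightarrow> h x = g x"
        "\<And>x. x \<in> topspace X \<Longrightarrow> \<bar>h x\<bar> \<le> b x"
        by blast
      have "T h \<in> topspace (Cp Y)" unfolding surj[symmetric] using h(1) by (rule imageI)
      then have cont: "continuous_map Y euclideanreal (T h)" by (simp add: topspace_Cp)
      define U where "U = {z \<in> topspace Y. T h z \<in> {f y<..}}"
      have "openin Y U"
        unfolding U_def using cont by (rule openin_continuous_map_preimage) simp
      moreover have "T h y = f y + 1"
        using T_eq[OF y h(1)] g y h(2) by simp
      then have "y \<in> U" using y by (simp add: U_def)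
      moreover have "f y \<le> (\<Sum>x\<in>F z. \<bar>c z x\<bar> * b x)" if "z \<in> U" for z
      proof -
        have z: "z \<in> topspace Y" and less: "f y < T h z" using that by (auto simp: U_def)
        have "T h z \<le> (\<Sum>x\<in>F z. \<bar>c z x\<bar> * b x)"
          unfolding T_eq[OF z h(1)]
        proof (rule sum_mono)
          fix x assume "x \<in> F z"
          then have "\<bar>h x\<bar> \<le> b x" using F(2)[OF z] h(3) by blast
          then have "\<bar>c z x * h x\<bar> \<le> \<bar>c z x\<bar> * b x"
            by (simp add: abs_mult mult_left_mono)
          then show "c z x * h x \<le> \<bar>c z x\<bar> * b x" by linarith
        qed
        with less show ?thesis by linarith
      qed
      ultimately show "\<exists>U. openin Y U \<and> y \<in> U \<and> (\<forall>z \<in> U. f y \<le> (\<Sum>x\<in>F z. \<bar>c z x\<bar> * b x))"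
        by blast
    qed
  qed
qed

end
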